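(* Let $\mathcal F$ be the collection of all non-empty subsets of $\mathbb N$, let $N\geq 2$, and let $G_1,G_2,\dots,G_N$ be non-bipartite connected simple graphs with the same finite set of nodes $X$, where $X$ is equipped with an arbitrary topology. Then $G_1,\dots,G_N$ are $d\mathcal F$-hypercyclic, strongly $d\mathcal F$-hypercyclic and strongly $d\mathcal F$-topologically transitive, and any element of $X$ is both a $d\mathcal F$-hypercyclic vector and a strong $d\mathcal F$-hypercyclic vector of $G_1,\dots,G_N$.
   Context: $\mathbb N=\{1,2,3,\dots\}$. A simple graph on a finite set $X$ with $|X|>1$ is given by a symmetric relation $\rho\subseteq X\times X$ with $(x,x)\notin\rho$ for all $x$; dynamical properties of graphs $G_1,\dots,G_N$ are those of their relations $\rho_1,\dots,\rho_N$. For a relation $\rho$ on $X$, $\rho^n$ is the $n$-fold composition, $\rho^n x:=\{y:(x,y)\in\rho^n\}$, $D(\rho^n):=\{x:\rho^n x\ne\emptyset\}$, $D_\infty(\rho):=\bigcap_{n\in\mathbb N}D(\rho^n)$. An element $x\in X$ is a $d\mathcal F$-hypercyclic vector of $\rho_1,\dots,\rho_N$ if $x\in\bigcap_{j=1}^N D_\infty(\rho_j)$ and for all non-empty open $V_1,\dots,V_N\subseteq X$, $\{n\in\mathbb N:\rho_j^n x\cap V_j\neq\emptyset\text{ for all }1\le j\le N\}\in\mathcal F$. It is a strong $d\mathcal F$-hypercyclic vector if there are elements $y_{j,n}\in\rho_j^n x$ ($1\le j\le N$, $n\in\mathbb N$) such that for all non-empty open $V_1,\dots,V_N\subseteq X$,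 $\{n\in\mathbb N:y_{j,n}\in V_j\text{ for all }1\le j\le N\}\in\mathcal F$. The relations are (strongly) $d\mathcal F$-hypercyclic if they have a (strong) $d\mathcal F$-hypercyclic vector. They are strongly $d\mathcal F$-topologically transitive if for all non-empty open $U,V_1,\dots,V_N\subseteq X$ there is $x\in U$ and there are elements $y_{j,n}\in\rho_j^n x$ ($1\le j\le N$, $n\in\mathbb N$) such that $\{n\in\mathbb N:y_{j,n}\in V_j\text{ for all }1\le j\le N\}\in\mathcal F$. *)

theory Defs
  imports "HOL-Analysis.Abstract_Topology"
begin

section \<open>Simple graphs given by their adjacency relation\<close>

definition simple_graph :: "'a set \<Rightarrow> ('a \<times> 'a) set \<Rightarrow> bool" where
  "simple_graph X \<rho> \<longleftrightarrow>
     finite X \<and> card X > 1 \<and> \<rho> \<subseteq> X \<times> X \<and> sym \<rho> \<and> (\<forall>x. (x, x) \<notin> \<rho>)"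

definition graph_connected :: "'a set \<Rightarrow> ('a \<times> 'a) set \<Rightarrow> bool" where
  "graph_connected X \<rho> \<longleftrightarrow> (\<forall>x\<in>X. \<forall>y\<in>X. (x, y) \<in> \<rho>\<^sup>*)"

definition graph_bipartite :: "'a set \<Rightarrow> ('a \<times> 'a) set \<Rightarrow> bool" where
  "graph_bipartite X \<rho> \<longleftrightarrow>
     (\<exists>A B. A \<union> B = X \<and> A \<inter> B = {} \<and> \<rho> \<subseteq> A \<times> B \<union> B \<times> A)"


section \<open>Disjoint hypercyclicity and transitivity of finitely many relations\<close>

text \<open>
  The space is \<open>topspace T\<close> for an arbitrary topology \<open>T\<close>, the relations are
  \<open>\<rho> 1, \<dots>, \<rho> N\<close>, and the set of positive integers is \<open>{1..} :: nat set\<close>.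
  The set of all \<open>y\<close> with \<open>(x, y) \<in> \<rho> ^^ n\<close> is the relational image \<open>(\<rho> ^^ n) `` {x}\<close>.
\<close>

definition D_infinity :: "('a \<times> 'a) set \<Rightarrow> 'a set" where
  "D_infinity \<rho> = (\<Inter>n\<in>{1..}. Domain (\<rho> ^^ n))"

definition dF_hypercyclic_vector ::
  "nat set set \<Rightarrow> 'a topology \<Rightarrow> nat \<Rightarrow> (nat \<Rightarrow> ('a \<times> 'a) set) \<Rightarrow> 'a \<Rightarrow> bool" where
  "dF_hypercyclic_vector F T N \<rho> x \<longleftrightarrow>
     x \<in> topspace T \<and> x \<in> (\<Inter>j\<in>{1..N}. D_infinity (\<rho> j)) \<and>
     (\<forall>V. (\<forall>j\<in>{1..N}. openin T (V j) \<and> V j \<noteq> {}) \<longrightarrow>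
        {n \<in> {1..}. \<forall>j\<in>{1..N}. (\<rho> j ^^ n) `` {x} \<inter> V j \<noteq> {}} \<in> F)"

definition strong_dF_hypercyclic_vector ::
  "nat set set \<Rightarrow> 'a topology \<Rightarrow> nat \<Rightarrow> (nat \<Rightarrow> ('a \<times> 'a) set) \<Rightarrow> 'a \<Rightarrow> bool" where
  "strong_dF_hypercyclic_vector F T N \<rho> x \<longleftrightarrow>
     x \<in> topspace T \<and>
     (\<exists>y. (\<forall>j\<in>{1..N}. \<forall>n\<in>{1..}. y j n \<in> (\<rho> j ^^ n) `` {x}) \<and>
        (\<forall>V. (\<forall>j\<in>{1..N}. openin T (V j) \<and> V j \<noteq> {}) \<longrightarrow>
           {n \<in> {1..}. \<forall>j\<in>{1..N}. y j n \<in> V j} \<in> F))"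

definition dF_hypercyclic ::
  "nat set set \<Rightarrow> 'a topology \<Rightarrow> nat \<Rightarrow> (nat \<Rightarrow> ('a \<times> 'a) set) \<Rightarrow> bool" where
  "dF_hypercyclic F T N \<rho> \<longleftrightarrow> (\<exists>x. dF_hypercyclic_vector F T N \<rho> x)"

definition strongly_dF_hypercyclic ::
  "nat set set \<Rightarrow> 'a topology \<Rightarrow> nat \<Rightarrow> (nat \<Rightarrow> ('a \<times> 'a) set) \<Rightarrow> bool" where
  "strongly_dF_hypercyclic F T N \<rho> \<longleftrightarrow> (\<exists>x. strong_dF_hypercyclic_vector F T N \<rho> x)"

definition strongly_dF_topologically_transitive ::
  "nat set set \<Rightarrow> 'a topology \<Rightarrow> nat \<Rightarrow> (nat \<Rightarrow> ('a \<times> 'a) set) \<Rightarrow> bool" where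
  "strongly_dF_topologically_transitive F T N \<rho> \<longleftrightarrow>
     (\<forall>U V. openin T U \<and> U \<noteq> {} \<and> (\<forall>j\<in>{1..N}. openin T (V j) \<and> V j \<noteq> {}) \<longrightarrow>
        (\<exists>x\<in>U. \<exists>y. (\<forall>j\<in>{1..N}. \<forall>n\<in>{1..}. y j n \<in> (\<rho> j ^^ n) `` {x}) \<and>
           {n \<in> {1..}. \<forall>j\<in>{1..N}. y j n \<in> V j} \<in> F))"

end

theory Submission
  imports Defs "HOL-Library.Countable_Set"
begin

text \<open>
  A connected non-bipartite graph has an odd closed walk through every node \<open>x\<close>. Padding it with
  back-and-forth moves along an edge at \<open>x\<close> gives closed walks of all large lengths, hence all
  nodes are reached from \<open>x\<close> by walks of every large length. After a common threshold the walks
  of the \<open>N\<close> graphs can therefore be sent to arbitrary targets, and the orbit \<open>y j n\<close> is chosen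
  so that as \<open>n\<close> grows it runs through all of the finitely many tuples of nodes.
\<close>

lemma sym_relpow:
  assumes "sym r"
  shows "sym (r ^^ n)"
proof (induction n)
  case (Suc n)
  then show ?case
    using assms by (simp add: sym_conv_converse_eq converse_relcomp relpow_commute)
qed (simp add: sym_def)

lemma relpow_add_I:
  assumes "(x, y) \<in> r ^^ m" "(y, z) \<in> r ^^ n"
  shows "(x, z) \<in> r ^^ (m + n)"
  using assms by (auto simp: relpow_add)

text \<open>If no node could be reached from \<open>x\<close> by walks of both parities, splitting
  the nodes by the parity of these walks would give a bipartition.\<close>

lemma odd_closed_walk:
  assumes X: "r \<subseteq> X \<times> X" and s: "sym r" and c: "graph_connected X r"
    and nb: "\<not> graph_bipartite X r" and x: "x \<in> X"
  obtains k where "odd k" "(x, x) \<in> r ^^ k"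
proof -
  define A where "A = {y \<in> X. \<exists>n. even n \<and> (x, y) \<in> r ^^ n}"
  define B where "B = {y \<in> X. \<exists>n. odd n \<and> (x, y) \<in> r ^^ n}"
  have U: "A \<union> B = X"
  proof -
    have "\<exists>n. (x, y) \<in> r ^^ n" if "y \<in> X" for y
      using c x that by (meson graph_connected_def rtrancl_imp_relpow)
    then show ?thesis unfolding A_def B_def by blast
  qed
  have AB: "v \<in> B" if "(u, v) \<in> r" "u \<in> A" for u v
    using that X unfolding A_def B_def by (auto intro!: exI[of _ "Suc _"])
  have BA: "v \<in> A" if "(u, v) \<in> r" "u \<in> B" for u v
    using that X unfolding A_def B_def by (auto intro!: exI[of _ "Suc _"])
  have "r \<subseteq> A \<times> B \<union> B \<times> A"
    using U X AB BA by fast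
  then have "A \<inter> B \<noteq> {}"
    using U nb unfolding graph_bipartite_def by blast
  then obtain y m n where mn: "even m" "odd n" "(x, y) \<in> r ^^ m" "(x, y) \<in> r ^^ n"
    unfolding A_def B_def by blast
  \<comment> \<open>Go out to \<open>y\<close> along the even walk and return along the reversed odd
    one.\<close>
  have "(x, x) \<in> r ^^ (m + n)"
    using mn sym_relpow[OF s, of n] by (meson relpow_add_I symD)
  then show ?thesis using mn that[of "m + n"] by simp
qed

lemma eventually_relpow:
  assumes X: "r \<subseteq> X \<times> X" and s: "sym r" and c: "graph_connected X r"
    and nb: "\<not> graph_bipartite X r" and x: "x \<in> X" and y: "y \<in> X"
  shows "\<forall>\<^sub>F n in sequentially. (x, y) \<in> r ^^ n"
proof -
  obtain k where k: "odd k" "(x, x) \<in> r ^^ k"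
    using odd_closed_walk[OF X s c nb x] .
  \<comment> \<open>An odd \<open>k\<close> is positive, so the closed walk has a first
    edge.\<close>
  obtain z where z: "(x, z) \<in> r"
    using k by (metis even_zero not0_implies_Suc relpow_Suc_D2)
  have two: "(x, x) \<in> r ^^ 2"
    using z s by (auto simp: numeral_2_eq_2 dest: symD)
  have ev: "(x, x) \<in> r ^^ (2 * i)" for i
  proof (induction i)
    case (Suc i)
    then show ?case using relpow_add_I[OF two Suc.IH] by simp
  qed simp
  \<comment> \<open>Even lengths come from back-and-forth moves alone; an odd \<open>n\<close>
    exceeds the odd \<open>k\<close> by an even amount.\<close>
  have closed: "(x, x) \<in> r ^^ n" if "n \<ge> k" for n
  proof (cases "even n")
    case True
    then show ?thesis using ev by (auto elim: evenE)
  next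
    case False
    then have "even (n - k)" using k by simp
    then obtain i where "n - k = 2 * i" by (elim evenE)
    then have "n = k + 2 * i" using that by simp
    then show ?thesis using relpow_add_I[OF k(2) ev[of i]] by simp
  qed
  obtain p where p: "(x, y) \<in> r ^^ p"
    using c x y by (meson graph_connected_def rtrancl_imp_relpow)
  have "(x, y) \<in> r ^^ n" if "n \<ge> k + p" for n
    using relpow_add_I[OF closed[of "n - p"] p] that by simp
  then show ?thesis by (auto simp: eventually_sequentially)
qed

text \<open>A long walk can be cut after \<open>n\<close> steps. This supplies orbit points for the
  small \<open>n\<close> at which the target may still be out of reach.\<close>

lemma relpow_Image_nonempty_le:
  fixes r :: "('a \<times> 'a) set"
  assumes "(x, y) \<in> r ^^ m" "n \<le> m"
  shows "(r ^^ n) `` {x} \<noteq> {}"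
proof -
  have "(x, y) \<in> r ^^ n O r ^^ (m - n)"
    using assms by (simp flip: relpow_add)
  then show ?thesis by blast
qed

text \<open>The strong notions fix \<open>y\<close> before the open sets are given, so one choice of
  orbits has to serve every tuple of targets.\<close>

lemma orbits_hitting_all_tuples:
  fixes \<rho> :: "nat \<Rightarrow> ('a \<times> 'a) set"
  assumes J: "finite J" and X: "finite X" "X \<noteq> {}"
    and ev: "\<And>j z. j \<in> J \<Longrightarrow> z \<in> X \<Longrightarrow> \<forall>\<^sub>F n in sequentially. (x, z) \<in> \<rho> j ^^ n"
  obtains y where "\<And>j n. j \<in> J \<Longrightarrow> y j n \<in> (\<rho> j ^^ n) `` {x}"
    and "\<And>p. p \<in> J \<rightarrow> X \<Longrightarrow> \<exists>n\<ge>1. \<forall>j\<in>J. y j n = p j"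
proof -
  \<comment> \<open>Finitely many pairs of \<open>j\<close> and \<open>z\<close> share one
    threshold.\<close>
  have "\<forall>\<^sub>F n in sequentially. \<forall>j\<in>J. \<forall>z\<in>X. (x, z) \<in> \<rho> j ^^ n"
    using J X ev by (simp add: eventually_ball_finite)
  then obtain n0 where n0: "\<And>n j z. n \<ge> n0 \<Longrightarrow> j \<in> J \<Longrightarrow> z \<in> X \<Longrightarrow> (x, z) \<in> \<rho> j ^^ n"
    by (auto simp: eventually_sequentially)
  have ne: "(\<rho> j ^^ n) `` {x} \<noteq> {}" if j: "j \<in> J" for j n
  proof -
    obtain z where "z \<in> X" using X by blast
    then have "(x, z) \<in> \<rho> j ^^ (n0 + n)" using n0 j by simp
    then show ?thesis by (rule relpow_Image_nonempty_le) simp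
  qed
  \<comment> \<open>Extensional functions represent each tuple exactly once, which keeps
    \<open>P\<close> finite and hence enumerable by \<open>from_nat_into\<close>.\<close>
  define P where "P = (J \<rightarrow>\<^sub>E X)"
  have P: "countable P" "P \<noteq> {}"
    using J X by (simp_all add: P_def countable_finite finite_PiE PiE_eq_empty_iff)
  define e where "e = from_nat_into P"
  have e: "e i \<in> P" for i
    unfolding e_def using P by (simp add: from_nat_into)
  \<comment> \<open>The enumeration starts with \<open>e 0\<close> at time \<open>Suc n0\<close>, so
    every tuple is met at a positive time past the threshold. Up to \<open>n0\<close> any reachable
    node will do.\<close>
  define y where
    "y j n = (if n > n0 then e (n - Suc n0) j else SOME z. z \<in> (\<rho> j ^^ n) `` {x})" for j n
  show ?thesis
  proof
    show "y j n \<in> (\<rho> j ^^ n) `` {x}" if j: "j \<in> J" for j n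
    proof (cases "n > n0")
      case True
      have "e (n - Suc n0) j \<in> X" using e j by (auto simp: P_def)
      then show ?thesis using True n0 j by (simp add: y_def)
    next
      case False
      then show ?thesis
        using ne[OF j] by (auto simp: y_def some_in_eq simp del: Image_singleton_iff)
    qed
  next
    fix p assume "p \<in> J \<rightarrow> X"
    then have "restrict p J \<in> P" by (simp add: P_def)
    then obtain i where "e i = restrict p J"
      unfolding e_def using P by (metis from_nat_into_surj)
    then have "\<forall>j\<in>J. y j (Suc n0 + i) = p j"
      by (simp add: y_def)
    then show "\<exists>n\<ge>1. \<forall>j\<in>J. y j n = p j"
      by (intro exI[of _ "Suc n0 + i"]) simp
  qed
qed

theorem theorem3p11:
  fixes F :: "nat set set" and N :: nat and X :: "'a set"
    and T :: "'a topology" and \<rho> :: "nat \<Rightarrow> ('a \<times> 'a) set"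
  assumes "F = {A. A \<subseteq> {1..} \<and> A \<noteq> {}}"
    and "N \<ge> 2"
    and "finite X"
    and "topspace T = X"
    and "\<And>j. j \<in> {1..N} \<Longrightarrow> simple_graph X (\<rho> j)"
    and "\<And>j. j \<in> {1..N} \<Longrightarrow> graph_connected X (\<rho> j)"
    and "\<And>j. j \<in> {1..N} \<Longrightarrow> \<not> graph_bipartite X (\<rho> j)"
  shows "dF_hypercyclic F T N \<rho> \<and>
         strongly_dF_hypercyclic F T N \<rho> \<and>
         strongly_dF_topologically_transitive F T N \<rho> \<and>
         (\<forall>x\<in>X. dF_hypercyclic_vector F T N \<rho> x \<and> strong_dF_hypercyclic_vector F T N \<rho> x)"
proof -
  have "simple_graph X (\<rho> 1)" using assms(2,5) by simp
  then obtain x0 where x0: "x0 \<in> X"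
    unfolding simple_graph_def by fastforce
  \<comment> \<open>All the conclusions follow from this one statement about an arbitrary
    node.\<close>
  have orbits: "\<exists>y. (\<forall>j\<in>{1..N}. \<forall>n\<in>{1..}. y j n \<in> (\<rho> j ^^ n) `` {x}) \<and>
        (\<forall>V. (\<forall>j\<in>{1..N}. openin T (V j) \<and> V j \<noteq> {}) \<longrightarrow>
           {n \<in> {1..}. \<forall>j\<in>{1..N}. y j n \<in> V j} \<in> F)" if x: "x \<in> X" for x
  proof -
    have "\<forall>\<^sub>F n in sequentially. (x, z) \<in> \<rho> j ^^ n" if "j \<in> {1..N}" "z \<in> X" for j z
      using eventually_relpow[of "\<rho> j" X x z] assms(5-7)[OF that(1)] x that(2)
      by (auto simp: simple_graph_def)
    then obtain y where y: "\<And>j n. j \<in> {1..N} \<Longrightarrow> y j n \<in> (\<rho> j ^^ n) `` {x}"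
      and hit: "\<And>p. p \<in> {1..N} \<rightarrow> X \<Longrightarrow> \<exists>n\<ge>1. \<forall>j\<in>{1..N}. y j n = p j"
      using orbits_hitting_all_tuples[of "{1..N}" X x \<rho>] assms(3) x0 by blast
    have "{n \<in> {1..}. \<forall>j\<in>{1..N}. y j n \<in> V j} \<in> F"
      if V: "\<forall>j\<in>{1..N}. openin T (V j) \<and> V j \<noteq> {}" for V
    proof -
      \<comment> \<open>One point from each open set turns the sets into a tuple of nodes, which the
        orbits hit.\<close>
      define p where "p j = (SOME z. z \<in> V j)" for j
      have p: "p j \<in> V j" if "j \<in> {1..N}" for j
        using V that by (simp add: p_def some_in_eq)
      have "p \<in> {1..N} \<rightarrow> X"
        using p V assms(4) openin_subset by blast
      then obtain n where "n \<ge> 1" "\<forall>j\<in>{1..N}. y j n = p j"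
        using hit by blast
      then have "n \<in> {n \<in> {1..}. \<forall>j\<in>{1..N}. y j n \<in> V j}"
        using p by simp
      then show ?thesis unfolding assms(1) by blast
    qed
    with y show ?thesis by blast
  qed
  have strong: "strong_dF_hypercyclic_vector F T N \<rho> x" if "x \<in> X" for x
    unfolding strong_dF_hypercyclic_vector_def using orbits[OF that] that assms(4) by blast
  have weak: "dF_hypercyclic_vector F T N \<rho> x" if x: "x \<in> X" for x
  proof -
    obtain y where y: "\<forall>j\<in>{1..N}. \<forall>n\<in>{1..}. y j n \<in> (\<rho> j ^^ n) `` {x}"
      and hit: "\<And>V. \<forall>j\<in>{1..N}. openin T (V j) \<and> V j \<noteq> {} \<Longrightarrow>
           {n \<in> {1..}. \<forall>j\<in>{1..N}. y j n \<in> V j} \<in> F"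
      using orbits[OF x] by blast
    have "{n \<in> {1..}. \<forall>j\<in>{1..N}. (\<rho> j ^^ n) `` {x} \<inter> V j \<noteq> {}} \<in> F"
      if V: "\<forall>j\<in>{1..N}. openin T (V j) \<and> V j \<noteq> {}" for V
    proof -
      \<comment> \<open>A time at which the orbits lie in the \<open>V j\<close> is also a time at
        which the full images meet them, and \<open>F\<close> is closed under supersets within the
        positive integers.\<close>
      have "{n \<in> {1..}. \<forall>j\<in>{1..N}. y j n \<in> V j}
          \<subseteq> {n \<in> {1..}. \<forall>j\<in>{1..N}. (\<rho> j ^^ n) `` {x} \<inter> V j \<noteq> {}}"
        using y by blast
      then show ?thesis using hit[OF V] unfolding assms(1) by blast
    qed
    moreover have "x \<in> (\<Inter>j\<in>{1..N}. D_infinity (\<rho> j))"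
      using y unfolding D_infinity_def by blast
    ultimately show ?thesis
      unfolding dF_hypercyclic_vector_def using x assms(4) by blast
  qed
  have "strongly_dF_topologically_transitive F T N \<rho>"
    unfolding strongly_dF_topologically_transitive_def
  proof (intro allI impI)
    fix U V
    assume *: "openin T U \<and> U \<noteq> {} \<and> (\<forall>j\<in>{1..N}. openin T (V j) \<and> V j \<noteq> {})"
    \<comment> \<open>Any point of \<open>U\<close> works, since \<open>orbits\<close> holds at
      every node.\<close>
    then obtain x where "x \<in> U" "x \<in> X"
      using assms(4) openin_subset by blast
    then show "\<exists>x\<in>U. \<exists>y. (\<forall>j\<in>{1..N}. \<forall>n\<in>{1..}. y j n \<in> (\<rho> j ^^ n) `` {x}) \<and>
           {n \<in> {1..}. \<forall>j\<in>{1..N}. y j n \<in> V j} \<in> F"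
      using orbits[of x] * by blast
  qed
  then show ?thesis
    unfolding dF_hypercyclic_def strongly_dF_hypercyclic_def
    using strong weak x0 by blast
qed

end
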